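(* Let $f$ be a conformal e-predictor on a non-empty measurable space $\mathbf{Z}$, let $Z_1,Z_2,\dots$ be an exchangeable infinite sequence of $\mathbf{Z}$-valued random elements, and let $e_n:=f(Z_1,\dots,Z_n)$, $n=1,2,\dots$, be the conformal e-values. Let $c>1$ and define the alarm times of the conformal CUSUM e-procedure by $\tau_0:=0$ and \[ \tau_k:=\min\Bigl\{n>\tau_{k-1}:\ \max_{i\in\{\tau_{k-1}+1,\dots,n\}}e_i\cdots e_n\ge c\Bigr\},\qquad k=1,2,\dots. \] Let $A_n:=\max\{k\mid\tau_k\le n\}$ be the number of alarms raised after processing the first $n$ observations. Then \[ \limsup_{n\to\infty}\frac{A_n}{n}\le\frac1c\quad\text{a.s.} \]
   Context: For a set $X$, $X^+:=\bigcup_{n=1}^\infty X^n$ is the set of non-empty finite sequences of elements of $X$ (a measurable space if $X$ is). A nonconformity e-measure is a measurable function $A:\mathbf{Z}^+\to[0,\infty)^+$ mapping every finite sequence $(z_1,\dots,z_m)$, $m\ge1$, to a sequence $(\alpha_1,\dots,\alpha_m)$ of the same length such that (i) $\frac1m\sum_{i=1}^m\alpha_i\le1$, and (ii) (equivariance) for any $m$ and any permutation $\pi$ of $\{1,\dots,m\}$, if $(\alpha_1,\dots,\alpha_m)=A(z_1,\dots,z_m)$ then $(\alpha_{\pi(1)},\dots,\alpha_{\pi(m)})=A(z_{\pi(1)},\dots,z_{\pi(m)})$. The corresponding conformal e-predictor is $f:\mathbf{Z}^+\to[0,\infty)$, $f(z_1,\dots,z_m):=\alpha_m$ where $(\alpha_1,\dots,\alpha_m)=A(z_1,\dots,z_m)$.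 An infinite sequence of random elements is exchangeable if the joint distribution of each finite initial segment is invariant under permutations. Conventions: $n$ ranges over positive integers; $\min\emptyset:=\infty$ (so if $\tau_{k-1}=\infty$ then $\tau_k=\infty$); in the definition of $A_n$, $k$ ranges over $\{0,1,2,\dots\}$. *)

theory Defs
  imports "HOL-Probability.Probability" "HOL-Combinatorics.List_Permutation"
begin

text \<open>The measurable space \<open>X\<^sup>+\<close>, the disjoint union of the powers \<open>X\<^sup>n\<close> for \<open>n \<ge> 1\<close>: a set of
  non-empty lists is measurable iff its trace on each \<open>X\<^sup>n\<close> is measurable for the product
  sigma-algebra. Only the sets and the space matter; the measure is irrelevant.\<close>

definition seq_plus :: "'a measure \<Rightarrow> 'a list measure" where
  "seq_plus N = sigma (lists (space N) - {[]})
     {B. B \<subseteq> lists (space N) - {[]} \<and>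
         (\<forall>n\<ge>1. {x \<in> space (\<Pi>\<^sub>M i\<in>{..<n}. N). map x [0..<n] \<in> B} \<in> sets (\<Pi>\<^sub>M i\<in>{..<n}. N))}"

lemma space_seq_plus: "space (seq_plus N) = lists (space N) - {[]}"
  unfolding seq_plus_def by (rule space_measure_of) blast

lemma sets_seq_plus:
  "sets (seq_plus N) =
     {B. B \<subseteq> lists (space N) - {[]} \<and>
         (\<forall>n\<ge>1. {x \<in> space (\<Pi>\<^sub>M i\<in>{..<n}. N). map x [0..<n] \<in> B} \<in> sets (\<Pi>\<^sub>M i\<in>{..<n}. N))}"
    (is "_ = ?S")
proof -
  let ?\<Omega> = "lists (space N) - {[]}"
  have "sigma_algebra ?\<Omega> ?S"
    unfolding sigma_algebra_iff2
  proof (intro conjI ballI allI impI)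
    fix B assume B: "B \<in> ?S"
    have "{x \<in> space (\<Pi>\<^sub>M i\<in>{..<n}. N). map x [0..<n] \<in> ?\<Omega> - B} =
        space (\<Pi>\<^sub>M i\<in>{..<n}. N) - {x \<in> space (\<Pi>\<^sub>M i\<in>{..<n}. N). map x [0..<n] \<in> B}"
      if "1 \<le> n" for n
      using that by (auto simp: space_PiM PiE_def Pi_def)
    with B show "?\<Omega> - B \<in> ?S" by auto
  next
    fix B :: "nat \<Rightarrow> 'a list set" assume B: "range B \<subseteq> ?S"
    have "{x \<in> space (\<Pi>\<^sub>M i\<in>{..<n}. N). map x [0..<n] \<in> (\<Union>k. B k)} =
        (\<Union>k. {x \<in> space (\<Pi>\<^sub>M i\<in>{..<n}. N). map x [0..<n] \<in> B k})" for n
      by auto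
    with B show "(\<Union>k. B k) \<in> ?S" by (auto simp: image_subset_iff subset_iff)
  qed auto
  then show ?thesis
    unfolding seq_plus_def by (rule sigma_algebra.sets_measure_of_eq)
qed

definition nonconformity_e_measure :: "'a measure \<Rightarrow> ('a list \<Rightarrow> real list) \<Rightarrow> bool" where
  "nonconformity_e_measure N A \<longleftrightarrow>
     A \<in> measurable (seq_plus N) (seq_plus (restrict_space borel {0..})) \<and>
     (\<forall>zs \<in> space (seq_plus N).
        length (A zs) = length zs \<and>
        (1 / real (length zs)) * sum_list (A zs) \<le> 1 \<and>
        (\<forall>\<pi>. \<pi> permutes {..<length zs} \<longrightarrow> A (permute_list \<pi> zs) = permute_list \<pi> (A zs)))"

definition conformal_e_predictor :: "'a measure \<Rightarrow> ('a list \<Rightarrow> real) \<Rightarrow> bool" where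
  "conformal_e_predictor N f \<longleftrightarrow>
     (\<exists>A. nonconformity_e_measure N A \<and> (\<forall>zs \<in> space (seq_plus N). f zs = last (A zs)))"

text \<open>Random sequences are indexed from 0: \<open>Z 0, Z 1, \<dots>\<close> stand for \<open>Z\<^sub>1, Z\<^sub>2, \<dots>\<close>.\<close>

definition exchangeable :: "'w measure \<Rightarrow> 'a measure \<Rightarrow> (nat \<Rightarrow> 'w \<Rightarrow> 'a) \<Rightarrow> bool" where
  "exchangeable M N Z \<longleftrightarrow>
     (\<forall>i. Z i \<in> measurable M N) \<and>
     (\<forall>n \<pi>. \<pi> permutes {..<n} \<longrightarrow>
        distr M (\<Pi>\<^sub>M i\<in>{..<n}. N) (\<lambda>\<omega>. \<lambda>i\<in>{..<n}. Z (\<pi> i) \<omega>) =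
        distr M (\<Pi>\<^sub>M i\<in>{..<n}. N) (\<lambda>\<omega>. \<lambda>i\<in>{..<n}. Z i \<omega>))"

text \<open>The e-values are indexed from 1, by the number of observations used; the value at 0 plays
  no role.\<close>

definition conformal_e_value :: "('a list \<Rightarrow> real) \<Rightarrow> (nat \<Rightarrow> 'w \<Rightarrow> 'a) \<Rightarrow> 'w \<Rightarrow> nat \<Rightarrow> real" where
  "conformal_e_value f Z \<omega> n = f (map (\<lambda>i. Z i \<omega>) [0..<n])"

text \<open>On \<^typ>\<open>enat\<close>, an infimum is a minimum, except that \<open>Inf {} = \<infinity>\<close>.\<close>

primrec cusum_alarm_time :: "real \<Rightarrow> (nat \<Rightarrow> real) \<Rightarrow> nat \<Rightarrow> enat" where
  "cusum_alarm_time c e 0 = 0"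
| "cusum_alarm_time c e (Suc k) =
     Inf {enat n | n. cusum_alarm_time c e k < enat n \<and>
       c \<le> Max {\<Prod>j=i..n. e j | i. cusum_alarm_time c e k < enat i \<and> i \<le> n}}"

text \<open>The set below contains 0 and, since the finite alarm times increase strictly, is finite.\<close>

definition cusum_alarm_count :: "real \<Rightarrow> (nat \<Rightarrow> real) \<Rightarrow> nat \<Rightarrow> nat" where
  "cusum_alarm_count c e n = Max {k. cusum_alarm_time c e k \<le> enat n}"

end

theory Submission
  imports Defs
begin

text \<open>Fix \<open>n\<close> and read the e-values backwards, \<open>e\<^sub>n, e\<^bsub>n-1\<^esub>, \<dots>\<close>. Given the bag of the first \<open>i\<close>
  observations and all later observations, \<open>e\<^sub>i\<close> has conditional mean at most one, while
  \<open>e\<^bsub>i+1\<^esub>, \<dots>, e\<^sub>n\<close> are determined. The alarms by time \<open>n\<close> yield disjoint blocks with product at least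
  \<open>c\<close>, and the CUSUM procedure run backwards raises at least one alarm in each block, hence at least
  \<open>A\<^sub>n\<close> alarms. If \<open>D\<^sub>i \<in> [1, c]\<close> is the reverse CUSUM before \<open>e\<^sub>i\<close> is read, then \<open>c A\<^sub>n - n\<close> is at most
  the sum of the \<open>D\<^sub>i (min(e\<^sub>i, c) - 1)\<close>, the end value of a reverse-time supermartingale with bounded
  increments. An exponential moment bound and the Borel-Cantelli lemma finish the proof.\<close>

text \<open>Reduces an exponential moment to a mean: the linear term keeps the sign of the mean, and
  the quadratic term is bounded by a constant. Negative arguments are treated by hand.\<close>

lemma exp_le_quadratic:
  fixes x :: real
  assumes "\<bar>x\<bar> \<le> 1"
  shows "exp x \<le> 1 + x + x\<^sup>2"
proof (cases "0 \<le> x")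
  case True
  then show ?thesis using exp_bound[of x] assms by auto
next
  case False
  define y where "y = - x"
  have y: "0 \<le> y" using False by (simp add: y_def)
  have "1 + y + y\<^sup>2 / 2 \<le> exp y" using exp_lower_Taylor_quadratic[OF y] by simp
  moreover have pos: "0 \<le> 1 - y + y\<^sup>2" using y assms by (simp add: y_def)
  ultimately have "(1 - y + y\<^sup>2) * (1 + y + y\<^sup>2 / 2) \<le> (1 - y + y\<^sup>2) * exp y"
    by (rule mult_left_mono)
  \<comment> \<open>All negative terms cancel in this product, so it is at least one and
    \<open>1 - y + y\<^sup>2\<close> dominates \<open>exp (- y)\<close>.\<close>
  moreover have "(1 - y + y\<^sup>2) * (1 + y + y\<^sup>2 / 2) = 1 + y\<^sup>2 / 2 + y ^ 3 / 2 + y ^ 4 / 2"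
    by (simp add: field_simps power2_eq_square power3_eq_cube power4_eq_xxxx)
  moreover have "0 \<le> y\<^sup>2 / 2 + y ^ 3 / 2 + y ^ 4 / 2" using y by simp
  ultimately have "1 \<le> (1 - y + y\<^sup>2) * exp y" by linarith
  then have "exp (- y) \<le> (1 - y + y\<^sup>2) * exp y * exp (- y)"
    by (simp add: mult_right_mono)
  also have "\<dots> = 1 - y + y\<^sup>2" by (simp add: mult.assoc flip: exp_add)
  finally show ?thesis by (simp add: y_def)
qed

section \<open>Conformal e-predictors: permuted samples, sign, measurability\<close>

lemma map_upt_in_seq_plus:
  assumes "1 \<le> n" "x \<in> {..<n} \<rightarrow> space N"
  shows "map x [0..<n] \<in> space (seq_plus N)"
  using assms by (auto simp: space_seq_plus Pi_iff)

text \<open>By equivariance, permuting the sample merely selects another entry of one fixed score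
  vector. So a permutation fixing \<open>n - 1\<close> leaves the e-value unchanged, while
  transpositions with \<open>n - 1\<close> run through all scores.\<close>

lemma conformal_e_predictor_components:
  assumes f: "conformal_e_predictor N f" and n: "1 \<le> n" and x: "x \<in> {..<n} \<rightarrow> space N"
  obtains \<alpha> where "\<And>\<pi>. \<pi> permutes {..<n} \<Longrightarrow> f (map (x \<circ> \<pi>) [0..<n]) = \<alpha> (\<pi> (n - 1))"
    and "\<And>i. i < n \<Longrightarrow> 0 \<le> \<alpha> i" and "(\<Sum>i<n. \<alpha> i) \<le> real n"
proof -
  obtain A where A: "nonconformity_e_measure N A"
    and fA: "\<And>zs. zs \<in> space (seq_plus N) \<Longrightarrow> f zs = last (A zs)"
    using f unfolding conformal_e_predictor_def by blast
  let ?z = "map x [0..<n]"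
  have z: "?z \<in> space (seq_plus N)" by (rule map_upt_in_seq_plus[OF n x])
  have Az: "length (A ?z) = n" "1 / real n * sum_list (A ?z) \<le> 1"
    and eq: "\<And>\<pi>. \<pi> permutes {..<n} \<Longrightarrow> A (permute_list \<pi> ?z) = permute_list \<pi> (A ?z)"
    using A z unfolding nonconformity_e_measure_def by fastforce+
  \<comment> \<open>The sign of the scores is encoded in the codomain of \<open>A\<close>.\<close>
  have "A ?z \<in> space (seq_plus (restrict_space borel {0..}))"
    using A z unfolding nonconformity_e_measure_def by (auto dest: measurable_space)
  then have nn: "\<forall>a \<in> set (A ?z). 0 \<le> a" by (auto simp: space_seq_plus space_restrict_space)
  show ?thesis
  proof
    fix \<pi> assume p: "\<pi> permutes {..<n}"
    have lt: "\<pi> i < n" if "i < n" for i using permutes_in_image[OF p, of i] that by simp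
    have *: "permute_list \<pi> ?z = map (x \<circ> \<pi>) [0..<n]"
      using lt by (auto simp: permute_list_def)
    have "map (x \<circ> \<pi>) [0..<n] \<in> space (seq_plus N)"
      using x lt by (intro map_upt_in_seq_plus[OF n]) auto
    then have "f (map (x \<circ> \<pi>) [0..<n]) = last (permute_list \<pi> (A ?z))"
      using fA eq[OF p] * by metis
    also have "\<dots> = permute_list \<pi> (A ?z) ! (n - 1)"
      using n Az(1) by (subst last_conv_nth) (auto simp: permute_list_def)
    also have "\<dots> = A ?z ! \<pi> (n - 1)" using n Az(1) by (simp add: permute_list_def)
    finally show "f (map (x \<circ> \<pi>) [0..<n]) = A ?z ! \<pi> (n - 1)" .
  next
    show "0 \<le> A ?z ! i" if "i < n" for i using nn Az(1) that by simp
  next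
    show "(\<Sum>i<n. A ?z ! i) \<le> real n"
      using Az n by (simp add: sum_list_sum_nth atLeast0LessThan field_simps)
  qed
qed

lemma conformal_e_predictor_nonneg:
  assumes "conformal_e_predictor N f" "1 \<le> n" "x \<in> {..<n} \<rightarrow> space N"
  shows "0 \<le> f (map x [0..<n])"
proof -
  obtain \<alpha> where "\<And>\<pi>. \<pi> permutes {..<n} \<Longrightarrow> f (map (x \<circ> \<pi>) [0..<n]) = \<alpha> (\<pi> (n - 1))"
    and "\<And>i. i < n \<Longrightarrow> 0 \<le> \<alpha> i"
    using conformal_e_predictor_components[OF assms] by metis
  from this(1)[OF permutes_id] this(2)[of "n - 1"] assms(2) show ?thesis by simp
qed

text \<open>The domain has \<open>n\<close> coordinates although \<open>j\<close> are read, so that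
  all e-values up to time \<open>n\<close> live on one product space.\<close>

lemma conformal_e_predictor_measurable:
  assumes f: "conformal_e_predictor N f" and j: "1 \<le> j" "j \<le> n"
  shows "(\<lambda>x. f (map x [0..<j])) \<in> borel_measurable (\<Pi>\<^sub>M i\<in>{..<n}. N)"
proof -
  obtain A where A: "nonconformity_e_measure N A"
    and fA: "\<And>zs. zs \<in> space (seq_plus N) \<Longrightarrow> f zs = last (A zs)"
    using f unfolding conformal_e_predictor_def by blast
  let ?R = "restrict_space borel {0..} :: real measure"
  have AM: "A \<in> measurable (seq_plus N) (seq_plus ?R)"
    using A unfolding nonconformity_e_measure_def by blast
  \<comment> \<open>On the \<open>m\<close>-th power, \<open>last\<close> is the coordinate
    projection at \<open>m - 1\<close>.\<close>
  have last: "last \<in> borel_measurable (seq_plus ?R)"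
  proof (rule borel_measurableI_le)
    fix a :: real
    let ?B = "{l \<in> space (seq_plus ?R). last l \<le> a}"
    have "{x \<in> space (\<Pi>\<^sub>M i\<in>{..<m}. ?R). map x [0..<m] \<in> ?B} \<in> sets (\<Pi>\<^sub>M i\<in>{..<m}. ?R)"
      if m: "1 \<le> m" for m
    proof -
      have "(\<lambda>x. x (m - 1)) \<in> measurable (\<Pi>\<^sub>M i\<in>{..<m}. ?R) ?R"
        using m by (intro measurable_component_singleton) auto
      then have "(\<lambda>x. x (m - 1)) \<in> borel_measurable (\<Pi>\<^sub>M i\<in>{..<m}. ?R)"
        by (simp add: measurable_restrict_space2_iff)
      then have "{x \<in> space (\<Pi>\<^sub>M i\<in>{..<m}. ?R). x (m - 1) \<le> a} \<in> sets (\<Pi>\<^sub>M i\<in>{..<m}. ?R)"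
        by (rule borel_measurable_le) simp
      also have "{x \<in> space (\<Pi>\<^sub>M i\<in>{..<m}. ?R). x (m - 1) \<le> a}
          = {x \<in> space (\<Pi>\<^sub>M i\<in>{..<m}. ?R). map x [0..<m] \<in> ?B}"
        using m by (auto simp: last_map space_PiM PiE_def Pi_def space_seq_plus)
      finally show ?thesis .
    qed
    then show "?B \<in> sets (seq_plus ?R)"
      unfolding sets_seq_plus by (auto simp: space_seq_plus)
  qed
  have "f \<in> borel_measurable (seq_plus N)"
    using measurable_compose[OF AM last] measurable_cong[of "seq_plus N" f "\<lambda>zs. last (A zs)"] fA
    by simp
  moreover have "(\<lambda>x. map x [0..<j]) \<in> measurable (\<Pi>\<^sub>M i\<in>{..<j}. N) (seq_plus N)"
  proof (rule measurableI)
    fix x assume "x \<in> space (\<Pi>\<^sub>M i\<in>{..<j}. N)"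
    then show "map x [0..<j] \<in> space (seq_plus N)"
      using j by (intro map_upt_in_seq_plus) (auto simp: space_PiM)
  next
    fix B assume "B \<in> sets (seq_plus N)"
    then have "{x \<in> space (\<Pi>\<^sub>M i\<in>{..<j}. N). map x [0..<j] \<in> B} \<in> sets (\<Pi>\<^sub>M i\<in>{..<j}. N)"
      using j unfolding sets_seq_plus by auto
    then show "(\<lambda>x. map x [0..<j]) -` B \<inter> space (\<Pi>\<^sub>M i\<in>{..<j}. N) \<in> sets (\<Pi>\<^sub>M i\<in>{..<j}. N)"
      by (simp add: vimage_def Int_def conj_commute)
  qed
  ultimately have "(\<lambda>x. f (map x [0..<j])) \<in> borel_measurable (\<Pi>\<^sub>M i\<in>{..<j}. N)"
    by (rule measurable_compose[rotated])
  moreover have "(\<lambda>x. restrict x {..<j}) \<in> measurable (\<Pi>\<^sub>M i\<in>{..<n}. N) (\<Pi>\<^sub>M i\<in>{..<j}. N)"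
    using j by (intro measurable_restrict_subset) auto
  ultimately have "(\<lambda>x. f (map (restrict x {..<j}) [0..<j])) \<in> borel_measurable (\<Pi>\<^sub>M i\<in>{..<n}. N)"
    by (rule measurable_compose[rotated])
  moreover have "map (restrict x {..<j}) [0..<j] = map x [0..<j]" for x :: "nat \<Rightarrow> 'a" by auto
  ultimately show ?thesis by simp
qed

section \<open>The reverse CUSUM procedure\<close>

text \<open>Step \<open>t\<close> of the reverse procedure started at time \<open>n\<close> processes the e-value with index \<open>n - t\<close>.\<close>

primrec reverse_cusum :: "real \<Rightarrow> (nat \<Rightarrow> real) \<Rightarrow> nat \<Rightarrow> nat \<Rightarrow> real" where
  "reverse_cusum c e n 0 = 1"
| "reverse_cusum c e n (Suc t) =
     (let x = reverse_cusum c e n t * e (n - t) in if c \<le> x then 1 else max 1 x)"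

definition reverse_alarms :: "real \<Rightarrow> (nat \<Rightarrow> real) \<Rightarrow> nat \<Rightarrow> nat \<Rightarrow> nat set" where
  "reverse_alarms c e n t = {s. s < t \<and> c \<le> reverse_cusum c e n s * e (n - s)}"

definition reverse_gain :: "real \<Rightarrow> (nat \<Rightarrow> real) \<Rightarrow> nat \<Rightarrow> nat \<Rightarrow> real" where
  "reverse_gain c e n s = reverse_cusum c e n s * (min (e (n - s)) c - 1)"

lemma reverse_cusum_bounds:
  assumes "1 < c"
  shows "1 \<le> reverse_cusum c e n t" "reverse_cusum c e n t \<le> c"
  using assms by (induction t) (auto simp: Let_def)

text \<open>Predictability: only e-values with index above \<open>n - t\<close> have been read
  before step \<open>t\<close>.\<close>

lemma reverse_cusum_cong:
  assumes "\<And>j. n - t < j \<Longrightarrow> j \<le> n \<Longrightarrow> e j = e' j" "t \<le> n"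
  shows "reverse_cusum c e n t = reverse_cusum c e' n t"
  using assms
proof (induction t)
  case (Suc t)
  then have "reverse_cusum c e n t = reverse_cusum c e' n t" by simp
  moreover have "e (n - t) = e' (n - t)" using Suc.prems by simp
  ultimately show ?case by simp
qed simp

lemma abs_reverse_gain_le:
  assumes "1 < c" "0 \<le> e (n - s)"
  shows "\<bar>reverse_gain c e n s\<bar> \<le> c\<^sup>2"
proof -
  have "\<bar>reverse_gain c e n s\<bar> = reverse_cusum c e n s * \<bar>min (e (n - s)) c - 1\<bar>"
    using reverse_cusum_bounds(1)[OF assms(1), of e n s] by (simp add: reverse_gain_def abs_mult)
  \<comment> \<open>The second factor is at most \<open>c\<close> because
    \<open>min (e (n - s)) c - 1\<close> lies between \<open>- 1\<close> and
    \<open>c - 1\<close>.\<close>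
  also have "\<dots> \<le> c * c"
    using reverse_cusum_bounds[OF assms(1), of e n s] assms by (intro mult_mono) auto
  finally show ?thesis by (simp add: power2_eq_square)
qed

lemma finite_reverse_alarms [simp]: "finite (reverse_alarms c e n t)"
  unfolding reverse_alarms_def by auto

lemma card_reverse_alarms_Suc:
  "card (reverse_alarms c e n (Suc t)) = card (reverse_alarms c e n t) +
     (if c \<le> reverse_cusum c e n t * e (n - t) then 1 else 0)"
proof -
  have "reverse_alarms c e n (Suc t) =
     (if c \<le> reverse_cusum c e n t * e (n - t) then insert t (reverse_alarms c e n t)
      else reverse_alarms c e n t)"
    unfolding reverse_alarms_def by (auto simp: less_Suc_eq)
  moreover have "t \<notin> reverse_alarms c e n t" by (simp add: reverse_alarms_def)
  ultimately show ?thesis by simp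
qed

text \<open>Each alarm is worth \<open>c\<close>, and the reverse CUSUM minus one is the potential: with
  \<open>x = D e\<close>, both \<open>c \<le> x\<close> at an alarm and \<open>max 1 x - 1 \<le> x\<close> otherwise bound the new value by \<open>x\<close>.
  Truncating \<open>e\<close> at \<open>c\<close> preserves the alarms because \<open>D \<ge> 1\<close>, and it makes the gain bounded.\<close>

lemma reverse_alarms_le_gain:
  assumes c: "1 < c" and e: "\<And>j. 1 \<le> j \<Longrightarrow> 0 \<le> e j" and "t \<le> n"
  shows "c * real (card (reverse_alarms c e n t)) + (reverse_cusum c e n t - 1)
    \<le> real t + (\<Sum>s<t. reverse_gain c e n s)"
  using assms(3)
proof (induction t)
  case 0
  then show ?case by (simp add: reverse_alarms_def)
next
  case (Suc t)
  let ?D = "reverse_cusum c e n t" and ?e = "e (n - t)"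
  have D: "1 \<le> ?D" using reverse_cusum_bounds[OF c] by simp
  have e0: "0 \<le> ?e" using Suc.prems by (intro e) simp
  have IH: "c * real (card (reverse_alarms c e n t)) + (?D - 1)
    \<le> real t + (\<Sum>s<t. reverse_gain c e n s)" using Suc by simp
  show ?case
  proof (cases "c \<le> ?D * ?e")
    case True
    have "c \<le> ?D * min ?e c"
      using True D c by (cases "?e \<le> c") (auto intro: mult_right_mono[of 1 ?D c, simplified])
    then show ?thesis using IH True
      by (simp add: card_reverse_alarms_Suc reverse_gain_def algebra_simps Let_def)
  next
    case False
    have "?e \<le> ?D * ?e" using mult_right_mono[OF D e0] by simp
    then have "min ?e c = ?e" using False by simp
    moreover have "0 \<le> ?D * ?e" using D e0 by simp
    ultimately show ?thesis using IH False
      by (simp add: card_reverse_alarms_Suc reverse_gain_def algebra_simps Let_def)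
  qed
qed

text \<open>As long as no alarm resets it, the reverse CUSUM dominates the product accumulated from
  \<open>m\<close> downwards; having read \<open>i\<close> without an alarm, it would have reached
  \<open>c\<close>.\<close>

lemma reverse_alarm_exists:
  assumes c: "1 < c" and e: "\<And>j. 1 \<le> j \<Longrightarrow> 0 \<le> e j"
    and i: "1 \<le> i" "i \<le> m" "m \<le> n" and prod: "c \<le> (\<Prod>j=i..m. e j)"
  shows "\<exists>s. n - m \<le> s \<and> s \<le> n - i \<and> c \<le> reverse_cusum c e n s * e (n - s)"
proof (rule ccontr)
  assume "\<not> ?thesis"
  then have no: "reverse_cusum c e n s * e (n - s) < c" if "n - m \<le> s" "s \<le> n - i" for s
    using that by fastforce
  \<comment> \<open>Step \<open>n - m + d\<close> reads index \<open>m - d\<close>. The induction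
    starts from \<open>D \<ge> 1\<close>, whatever happened at indices above
    \<open>m\<close>.\<close>
  have "(\<Prod>j=m - d..m. e j) \<le> reverse_cusum c e n (n - m + d) * e (m - d)" if "d \<le> m - i" for d
    using that
  proof (induction d)
    case 0
    have "1 \<le> reverse_cusum c e n (n - m)" using reverse_cusum_bounds[OF c] by simp
    moreover have "0 \<le> e m" using i by (intro e) simp
    ultimately show ?case using mult_right_mono[of 1 "reverse_cusum c e n (n - m)" "e m"] by simp
  next
    case (Suc d)
    let ?s = "n - m + d"
    have s: "n - ?s = m - d" using i by simp
    have "reverse_cusum c e n ?s * e (n - ?s) < c" using Suc.prems i by (intro no) auto
    then have "reverse_cusum c e n (Suc ?s) \<ge> reverse_cusum c e n ?s * e (m - d)"
      by (simp add: Let_def s)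
    moreover have "(\<Prod>j=m - d..m. e j) \<le> reverse_cusum c e n ?s * e (m - d)"
      using Suc by simp
    ultimately have *: "(\<Prod>j=m - d..m. e j) \<le> reverse_cusum c e n (n - m + Suc d)" by simp
    have "{m - Suc d..m} = insert (m - Suc d) {m - d..m}" using Suc.prems i by auto
    moreover have "m - Suc d \<notin> {m - d..m}" using Suc.prems i by auto
    ultimately have "(\<Prod>j=m - Suc d..m. e j) = e (m - Suc d) * (\<Prod>j=m - d..m. e j)"
      by simp
    also have "\<dots> \<le> e (m - Suc d) * reverse_cusum c e n (n - m + Suc d)"
      using * Suc.prems i by (intro mult_left_mono e) auto
    finally show ?case by (simp add: mult.commute)
  qed
  from this[of "m - i"] have "(\<Prod>j=i..m. e j) \<le> reverse_cusum c e n (n - i) * e i" using i by simp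
  moreover have "reverse_cusum c e n (n - i) * e (n - (n - i)) < c" using i by (intro no) auto
  ultimately show False using prod i by simp
qed

section \<open>Forward alarms compared with reverse alarms\<close>

text \<open>Extracts the block responsible for an alarm. It starts after the previous alarm, so
  blocks of different alarms are disjoint.\<close>

lemma cusum_alarm_time_SucD:
  assumes "cusum_alarm_time c e (Suc k) = enat m"
  obtains l i where "cusum_alarm_time c e k = enat l" "l < i" "i \<le> m" "c \<le> (\<Prod>j=i..m. e j)"
proof -
  let ?T = "cusum_alarm_time c e k"
  let ?X = "{enat n | n. ?T < enat n \<and> c \<le> Max {\<Prod>j=i..n. e j | i. ?T < enat i \<and> i \<le> n}}"
  have "Inf ?X = enat m" using assms by simp
  \<comment> \<open>An empty set would have infinite infimum; a non-empty set of extended naturals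
    attains its infimum.\<close>
  moreover from this have "?X \<noteq> {}" by (metis Inf_enat_def enat.distinct(2))
  ultimately have "enat m \<in> ?X" using wellorder_InfI by (metis (no_types, lifting) equals0I)
  then have lt: "?T < enat m" and mx: "c \<le> Max {\<Prod>j=i..m. e j | i. ?T < enat i \<and> i \<le> m}"
    by auto
  from lt obtain l where l: "?T = enat l" by (cases ?T) auto
  let ?Y = "{\<Prod>j=i..m. e j | i. ?T < enat i \<and> i \<le> m}"
  have "?Y = (\<lambda>i. \<Prod>j=i..m. e j) ` {i. l < i \<and> i \<le> m}" using l by auto
  then have "finite ?Y" by simp
  \<comment> \<open>The index \<open>i = m\<close> is admissible.\<close>
  moreover have "?Y \<noteq> {}" using lt by auto
  ultimately have "Max ?Y \<in> ?Y" by (rule Max_in)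
  then show ?thesis using mx l that by auto
qed

lemma cusum_alarm_time_ge: "enat k \<le> cusum_alarm_time c e k"
proof (induction k)
  case 0
  then show ?case by (simp add: zero_enat_def[symmetric])
next
  case (Suc k)
  show ?case
  proof (cases "cusum_alarm_time c e (Suc k)")
    case (enat m)
    then obtain l i where "cusum_alarm_time c e k = enat l" "l < i" "i \<le> m"
      by (rule cusum_alarm_time_SucD)
    with Suc enat show ?thesis by simp
  qed simp
qed

text \<open>The term \<open>reverse_alarms c e n (n - m)\<close> collects the reverse alarms at
  indices above \<open>m\<close>. Going from alarm \<open>k\<close> at \<open>l\<close> to the next
  one at \<open>m\<close>, the block inside \<open>l + 1, ..., m\<close> contributes a reverse alarm
  not counted there, which drives the induction.\<close>

lemma alarm_time_le_reverse_alarms: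
  assumes c: "1 < c" and e: "\<And>j. 1 \<le> j \<Longrightarrow> 0 \<le> e j"
    and "cusum_alarm_time c e k = enat m" "m \<le> n"
  shows "k + card (reverse_alarms c e n (n - m)) \<le> card (reverse_alarms c e n n)"
  using assms(3,4)
proof (induction k arbitrary: m)
  case 0
  then show ?case by (simp add: zero_enat_def)
next
  case (Suc k)
  obtain l i where l: "cusum_alarm_time c e k = enat l" "l < i" "i \<le> m" "c \<le> (\<Prod>j=i..m. e j)"
    using Suc.prems(1) by (rule cusum_alarm_time_SucD)
  obtain s where s: "n - m \<le> s" "s \<le> n - i" "c \<le> reverse_cusum c e n s * e (n - s)"
    using reverse_alarm_exists[where e = e and i = i and m = m and n = n, OF c e] l Suc.prems by auto
  have "insert s (reverse_alarms c e n (n - m)) \<subseteq> reverse_alarms c e n (n - l)"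
    using s l Suc.prems unfolding reverse_alarms_def by auto
  then have "card (insert s (reverse_alarms c e n (n - m))) \<le> card (reverse_alarms c e n (n - l))"
    by (intro card_mono) auto
  moreover have "s \<notin> reverse_alarms c e n (n - m)" using s by (simp add: reverse_alarms_def)
  ultimately have "Suc (card (reverse_alarms c e n (n - m))) \<le> card (reverse_alarms c e n (n - l))"
    by simp
  moreover have "k + card (reverse_alarms c e n (n - l)) \<le> card (reverse_alarms c e n n)"
    using Suc.IH[OF l(1)] l Suc.prems by simp
  ultimately show ?case by simp
qed

text \<open>The pathwise half of the argument: no probability is involved.\<close>

lemma cusum_alarm_count_le:
  assumes c: "1 < c" and e: "\<And>j. 1 \<le> j \<Longrightarrow> 0 \<le> e j"
  shows "c * real (cusum_alarm_count c e n) \<le> real n + (\<Sum>s<n. reverse_gain c e n s)"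
proof -
  let ?K = "{k. cusum_alarm_time c e k \<le> enat n}"
  have "?K \<subseteq> {..n}" using order_trans[OF cusum_alarm_time_ge] by fastforce
  then have "finite ?K" by (rule finite_subset) simp
  moreover have "0 \<in> ?K" by simp
  ultimately have "cusum_alarm_count c e n \<in> ?K"
    unfolding cusum_alarm_count_def using Max_in by blast
  then obtain m where "cusum_alarm_time c e (cusum_alarm_count c e n) = enat m" "m \<le> n"
    by (metis (mono_tags) enat_ile enat_ord_simps(1) mem_Collect_eq)
  then have "cusum_alarm_count c e n \<le> card (reverse_alarms c e n n)"
    using alarm_time_le_reverse_alarms[OF c e] by force
  then have "c * real (cusum_alarm_count c e n) \<le> c * real (card (reverse_alarms c e n n))"
    using c by simp
  \<comment> \<open>The final potential \<open>reverse_cusum c e n n - 1\<close> is nonnegative and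
    is dropped.\<close>
  also have "\<dots> \<le> real n + (\<Sum>s<n. reverse_gain c e n s)"
    using reverse_alarms_le_gain[where e = e and t = n and n = n, OF c e] reverse_cusum_bounds(1)[OF c, of e n n] by simp
  finally show ?thesis .
qed

section \<open>Measurability, exchangeability and the exponential moment\<close>

lemma reverse_gain_cong:
  assumes "\<And>j. n - s \<le> j \<Longrightarrow> j \<le> n \<Longrightarrow> e j = e' j" "s \<le> n"
  shows "reverse_gain c e n s = reverse_gain c e' n s"
  using reverse_cusum_cong[of n s e e' c] assms by (simp add: reverse_gain_def)

lemma reverse_gain_measurable:
  assumes e: "\<And>j. 1 \<le> j \<Longrightarrow> j \<le> n \<Longrightarrow> (\<lambda>x. e x j) \<in> borel_measurable P" and s: "s < n"
  shows "(\<lambda>x. reverse_gain c (e x) n s) \<in> borel_measurable P"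
proof -
  have D: "(\<lambda>x. reverse_cusum c (e x) n t) \<in> borel_measurable P" if "t \<le> n" for t
    using that
  proof (induction t)
    case (Suc t)
    then have [measurable]: "(\<lambda>x. reverse_cusum c (e x) n t) \<in> borel_measurable P"
      "(\<lambda>x. e x (n - t)) \<in> borel_measurable P"
      using e by auto
    show ?case unfolding reverse_cusum.simps Let_def by measurable
  qed simp
  have [measurable]: "(\<lambda>x. reverse_cusum c (e x) n s) \<in> borel_measurable P"
    "(\<lambda>x. e x (n - s)) \<in> borel_measurable P"
    using e D s by auto
  show ?thesis unfolding reverse_gain_def by measurable
qed

text \<open>The hypothesis \<open>cong\<close> lets \<open>F\<close> act on whole sequences, whereas
  points of the product space are restricted to \<open>{..<n}\<close>.\<close>

lemma exchangeable_measurable: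
  fixes F :: "(nat \<Rightarrow> 'a) \<Rightarrow> real"
  assumes Z: "exchangeable M N Z" and F: "F \<in> borel_measurable (\<Pi>\<^sub>M i\<in>{..<n}. N)"
    and cong: "\<And>x y. (\<And>i. i < n \<Longrightarrow> x i = y i) \<Longrightarrow> F x = F y"
  shows "(\<lambda>\<omega>. F (\<lambda>i. Z (\<pi> i) \<omega>)) \<in> borel_measurable M"
proof -
  have "(\<lambda>\<omega>. \<lambda>i\<in>{..<n}. Z (\<pi> i) \<omega>) \<in> measurable M (\<Pi>\<^sub>M i\<in>{..<n}. N)"
    using Z by (intro measurable_restrict) (simp add: exchangeable_def)
  from measurable_compose[OF this F] show ?thesis
    using cong[of "\<lambda>i\<in>{..<n}. Z (\<pi> i) _" "\<lambda>i. Z (\<pi> i) _"] by (simp cong: measurable_cong)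
qed

text \<open>Both integrals are taken against the law of the first \<open>n\<close> observations,
  which \<open>\<pi>\<close> preserves.\<close>

lemma exchangeable_integral:
  fixes F :: "(nat \<Rightarrow> 'a) \<Rightarrow> real"
  assumes Z: "exchangeable M N Z" and F: "F \<in> borel_measurable (\<Pi>\<^sub>M i\<in>{..<n}. N)"
    and cong: "\<And>x y. (\<And>i. i < n \<Longrightarrow> x i = y i) \<Longrightarrow> F x = F y"
    and \<pi>: "\<pi> permutes {..<n}"
  shows "(\<integral>\<omega>. F (\<lambda>i. Z (\<pi> i) \<omega>) \<partial>M) = (\<integral>\<omega>. F (\<lambda>i. Z i \<omega>) \<partial>M)"
proof -
  have *: "(\<integral>\<omega>. F (\<lambda>i. Z (\<sigma> i) \<omega>) \<partial>M) =
      (\<integral>x. F x \<partial>distr M (\<Pi>\<^sub>M i\<in>{..<n}. N) (\<lambda>\<omega>. \<lambda>i\<in>{..<n}. Z (\<sigma> i) \<omega>))" for \<sigma>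
  proof -
    have "(\<lambda>\<omega>. \<lambda>i\<in>{..<n}. Z (\<sigma> i) \<omega>) \<in> measurable M (\<Pi>\<^sub>M i\<in>{..<n}. N)"
      using Z by (intro measurable_restrict) (simp add: exchangeable_def)
    from integral_distr[OF this F] show ?thesis
      using cong[of "\<lambda>i\<in>{..<n}. Z (\<sigma> i) _" "\<lambda>i. Z (\<sigma> i) _"] by simp
  qed
  show ?thesis using *[of \<pi>] *[of id] Z \<pi> by (simp add: exchangeable_def)
qed

text \<open>Conditioning is replaced by averaging over the transpositions of \<open>i - 1\<close> with \<open>k < i\<close>, where
  \<open>i = n - t\<close>: they leave the first \<open>t\<close> gains and the reverse CUSUM unchanged, and turn the e-value
  with index \<open>i\<close> into each of the \<open>i\<close> nonconformity e-scores, whose average is at most one.\<close>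

lemma expectation_exp_reverse_gain_le:
  assumes M: "prob_space M" and f: "conformal_e_predictor N f" and Z: "exchangeable M N Z"
    and c: "1 < c" and l: "0 \<le> l" "l * c\<^sup>2 \<le> 1" and "t \<le> n"
  shows "(\<integral>\<omega>. exp (l * (\<Sum>s<t. reverse_gain c (conformal_e_value f Z \<omega>) n s)) \<partial>M)
    \<le> (1 + (l * c\<^sup>2)\<^sup>2) ^ t"
  using assms(7)
proof (induction t)
  case 0
  then show ?case using M by (simp add: prob_space.prob_space)
next
  case (Suc t)
  interpret prob_space M by (rule M)
  \<comment> \<open>All quantities become functions of the observation sequence, so that it can be
    permuted. \<open>G\<close> carries the first \<open>t\<close> gains, \<open>H\<close> the next
    one. Position \<open>i - 1\<close> holds the last observation entering the e-value with index
    \<open>i\<close>.\<close>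
  define E where "E z = (\<lambda>j. f (map z [0..<j]))" for z
  define G where "G z = exp (l * (\<Sum>s<t. reverse_gain c (E z) n s))" for z
  define H where "H z = exp (l * reverse_gain c (E z) n t)" for z
  define i where "i = n - t"
  define \<tau> where "\<tau> k = Transposition.transpose k (i - 1)" for k
  define K where "K = 1 + (l * c\<^sup>2)\<^sup>2"
  have i: "1 \<le> i" "i \<le> n" "t < n" "n - t = i" using Suc.prems by (auto simp: i_def)
  have Z_space: "Z j \<omega> \<in> space N" if "\<omega> \<in> space M" for j \<omega>
    using Z that unfolding exchangeable_def by (meson measurable_space)
  have E_nonneg: "0 \<le> E (\<lambda>r. Z (\<pi> r) \<omega>) j" if "\<omega> \<in> space M" "1 \<le> j" for \<omega> \<pi> j
    unfolding E_def using Z_space that by (intro conformal_e_predictor_nonneg[OF f]) auto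
  have E_cong: "E x j = E y j" if "\<And>r. r < j \<Longrightarrow> x r = y r" for x y j
    using that by (auto simp: E_def intro!: arg_cong[where f = f])
  have gain_cong: "reverse_gain c (E x) n s = reverse_gain c (E y) n s"
    if "\<And>r. r < n \<Longrightarrow> x r = y r" "s \<le> n" for x y s
    using that by (intro reverse_gain_cong E_cong) auto
  have gain_meas: "(\<lambda>x. reverse_gain c (E x) n s) \<in> borel_measurable (\<Pi>\<^sub>M i\<in>{..<n}. N)"
    if "s < n" for s
    using that unfolding E_def
    by (intro reverse_gain_measurable conformal_e_predictor_measurable[OF f])
  have G_meas: "G \<in> borel_measurable (\<Pi>\<^sub>M i\<in>{..<n}. N)"
  proof -
    have [measurable]: "(\<lambda>x. \<Sum>s<t. reverse_gain c (E x) n s) \<in> borel_measurable (\<Pi>\<^sub>M i\<in>{..<n}. N)"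
      using i by (intro borel_measurable_sum gain_meas) auto
    show ?thesis unfolding G_def by measurable
  qed
  have H_meas: "H \<in> borel_measurable (\<Pi>\<^sub>M i\<in>{..<n}. N)"
  proof -
    note gain_meas[OF i(3), measurable]
    show ?thesis unfolding H_def by measurable
  qed
  have G_cong: "G x = G y" if "\<And>r. r < n \<Longrightarrow> x r = y r" for x y
    unfolding G_def using gain_cong[OF that] i by simp
  have H_cong: "H x = H y" if "\<And>r. r < n \<Longrightarrow> x r = y r" for x y
    unfolding H_def using gain_cong[OF that] i by simp
  \<comment> \<open>These upper bounds serve integrability.\<close>
  have gain_le: "reverse_gain c (E (\<lambda>r. Z (\<pi> r) \<omega>)) n s \<le> c\<^sup>2"
    if "\<omega> \<in> space M" "s < n" for \<omega> \<pi> s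
    using abs_reverse_gain_le[OF c, of "E (\<lambda>r. Z (\<pi> r) \<omega>)" n s] E_nonneg that by simp
  have G_le: "G (\<lambda>r. Z (\<pi> r) \<omega>) \<le> exp (l * (\<Sum>s<t. c\<^sup>2))" if "\<omega> \<in> space M" for \<omega> \<pi>
    unfolding G_def using that l i by (intro exp_le_cancel_iff[THEN iffD2] mult_left_mono sum_mono gain_le) auto
  have H_le: "H (\<lambda>r. Z (\<pi> r) \<omega>) \<le> exp (l * c\<^sup>2)" if "\<omega> \<in> space M" for \<omega> \<pi>
    unfolding H_def using that l i by (intro exp_le_cancel_iff[THEN iffD2] mult_left_mono gain_le) auto
  have G_pos: "0 \<le> G z" and H_pos: "0 \<le> H z" for z by (simp_all add: G_def H_def)
  have G_int: "integrable M (\<lambda>\<omega>. G (\<lambda>r. Z r \<omega>))"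
    using exchangeable_measurable[OF Z G_meas G_cong, of id] G_le[of _ id] G_pos
    by (intro integrable_const_bound[where B = "exp (l * (\<Sum>s<t. c\<^sup>2))"]) auto
  have GH_int: "integrable M (\<lambda>\<omega>. G (\<lambda>r. Z r \<omega>) * H (\<lambda>r. Z (\<pi> r) \<omega>))" for \<pi>
    using exchangeable_measurable[OF Z G_meas G_cong, of id]
      exchangeable_measurable[OF Z H_meas H_cong, of \<pi>] G_le[of _ id] H_le[of _ \<pi>] G_pos H_pos
    by (intro integrable_const_bound[where B = "exp (l * (\<Sum>s<t. c\<^sup>2)) * exp (l * c\<^sup>2)"])
       (auto simp: abs_mult intro!: mult_mono)
  have \<tau>: "\<tau> k permutes {..<i}" if "k < i" for k
    unfolding \<tau>_def using that by (intro permutes_swap_id) auto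
  \<comment> \<open>As \<open>i < j\<close>, position \<open>j - 1\<close> is outside
    \<open>{..<i}\<close> and is fixed by \<open>\<tau> k\<close>.\<close>
  have E_inv: "E (\<lambda>r. z (\<tau> k r)) j = E z j"
    if "k < i" "i < j" "z \<in> {..<n} \<rightarrow> space N" "j \<le> n" for k j z
  proof -
    have "1 \<le> j" "z \<in> {..<j} \<rightarrow> space N" using that by auto
    then obtain \<alpha> where \<alpha>: "\<And>\<pi>. \<pi> permutes {..<j} \<Longrightarrow> f (map (z \<circ> \<pi>) [0..<j]) = \<alpha> (\<pi> (j - 1))"
      by (rule conformal_e_predictor_components[OF f]) blast
    have p: "\<tau> k permutes {..<j}" using that by (intro permutes_subset[OF \<tau>]) auto
    have "\<tau> k (j - 1) = j - 1" using \<tau>[OF that(1)] that by (auto simp: permutes_def)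
    then show ?thesis
      using \<alpha>[OF p] \<alpha>[OF permutes_id] by (simp add: E_def comp_def)
  qed
  have D_inv: "reverse_cusum c (E (\<lambda>r. z (\<tau> k r))) n s = reverse_cusum c (E z) n s"
    if "k < i" "z \<in> {..<n} \<rightarrow> space N" "s \<le> t" for k z s
    using that i by (intro reverse_cusum_cong E_inv) auto
  have G_inv: "G (\<lambda>r. z (\<tau> k r)) = G z" if "k < i" "z \<in> {..<n} \<rightarrow> space N" for k z
  proof -
    have "reverse_gain c (E (\<lambda>r. z (\<tau> k r))) n s = reverse_gain c (E z) n s" if "s < t" for s
      using that \<open>k < i\<close> \<open>z \<in> _\<close> i by (intro reverse_gain_cong E_inv) auto
    then show ?thesis by (simp add: G_def)
  qed
  \<comment> \<open>The reverse CUSUM is the same for all \<open>k\<close>, while the e-value runs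
    through the scores; hence the linear terms of the exponentials sum to at most zero.\<close>
  have H_sum: "(\<Sum>k<i. H (\<lambda>r. z (\<tau> k r))) \<le> real i * K" if z: "z \<in> {..<n} \<rightarrow> space N" for z
  proof -
    have "z \<in> {..<i} \<rightarrow> space N" using z i by auto
    with i(1) obtain \<alpha> where \<alpha>: "\<And>\<pi>. \<pi> permutes {..<i} \<Longrightarrow> f (map (z \<circ> \<pi>) [0..<i]) = \<alpha> (\<pi> (i - 1))"
      and \<alpha>0: "\<And>k. k < i \<Longrightarrow> 0 \<le> \<alpha> k" and \<alpha>s: "(\<Sum>k<i. \<alpha> k) \<le> real i"
      by (rule conformal_e_predictor_components[OF f]) blast
    let ?D = "reverse_cusum c (E z) n t"
    have D: "1 \<le> ?D" using reverse_cusum_bounds[OF c] by simp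
    have Ek: "E (\<lambda>r. z (\<tau> k r)) i = \<alpha> k" if "k < i" for k
      using \<alpha>[OF \<tau>[OF that]] by (simp add: E_def comp_def \<tau>_def)
    have "H (\<lambda>r. z (\<tau> k r)) \<le> K + l * ?D * (\<alpha> k - 1)" if k: "k < i" for k
    proof -
      let ?g = "reverse_gain c (E (\<lambda>r. z (\<tau> k r))) n t"
      have g: "?g = ?D * (min (\<alpha> k) c - 1)"
        using D_inv[OF k z, of t] Ek[OF k] i by (simp add: reverse_gain_def)
      have "\<bar>?g\<bar> \<le> c\<^sup>2" using abs_reverse_gain_le[OF c] Ek[OF k] \<alpha>0[OF k] i by simp
      then have lg: "\<bar>l * ?g\<bar> \<le> l * c\<^sup>2" using l by (simp add: abs_mult mult_left_mono)
      then have "exp (l * ?g) \<le> 1 + l * ?g + (l * ?g)\<^sup>2" using l by (intro exp_le_quadratic) auto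
      moreover have "(l * ?g)\<^sup>2 \<le> (l * c\<^sup>2)\<^sup>2" using power_mono[OF lg, of 2] by simp
      \<comment> \<open>Truncation only lowers the score, and its coefficient is
        nonnegative.\<close>
      moreover have "l * ?g \<le> l * ?D * (\<alpha> k - 1)"
        unfolding g mult.assoc using l D by (intro mult_left_mono) auto
      ultimately show ?thesis by (simp add: H_def K_def)
    qed
    then have "(\<Sum>k<i. H (\<lambda>r. z (\<tau> k r))) \<le> (\<Sum>k<i. K + l * ?D * (\<alpha> k - 1))"
      by (intro sum_mono) auto
    also have "\<dots> = real i * K + l * ?D * ((\<Sum>k<i. \<alpha> k) - real i)"
      by (simp add: sum.distrib sum_subtractf flip: sum_distrib_left)
    also have "\<dots> \<le> real i * K"
      using \<alpha>s l D by (simp add: mult_nonneg_nonpos)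
    finally show ?thesis .
  qed
  have Zn: "(\<lambda>r. Z r \<omega>) \<in> {..<n} \<rightarrow> space N" if "\<omega> \<in> space M" for \<omega> using Z_space that by auto
  \<comment> \<open>First \<open>G\<close> absorbs the transposition pointwise; then exchangeability
    removes it from both factors at once.\<close>
  have swap: "(\<integral>\<omega>. G (\<lambda>r. Z r \<omega>) * H (\<lambda>r. Z (\<tau> k r) \<omega>) \<partial>M) = (\<integral>\<omega>. G (\<lambda>r. Z r \<omega>) * H (\<lambda>r. Z r \<omega>) \<partial>M)"
    if k: "k < i" for k
  proof -
    have "(\<integral>\<omega>. G (\<lambda>r. Z r \<omega>) * H (\<lambda>r. Z (\<tau> k r) \<omega>) \<partial>M)
        = (\<integral>\<omega>. G (\<lambda>r. Z (\<tau> k r) \<omega>) * H (\<lambda>r. Z (\<tau> k r) \<omega>) \<partial>M)"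
      using G_inv[OF k Zn] by (intro Bochner_Integration.integral_cong) auto
    also have "\<dots> = (\<integral>\<omega>. G (\<lambda>r. Z r \<omega>) * H (\<lambda>r. Z r \<omega>) \<partial>M)"
    proof (rule exchangeable_integral[OF Z, where F = "\<lambda>z. G z * H z" and n = n])
      show "(\<lambda>z. G z * H z) \<in> borel_measurable (\<Pi>\<^sub>M i\<in>{..<n}. N)"
        using G_meas H_meas by simp
      show "G x * H x = G y * H y" if "\<And>r. r < n \<Longrightarrow> x r = y r" for x y
        using G_cong[OF that] H_cong[OF that] by simp
      show "\<tau> k permutes {..<n}" using i by (intro permutes_subset[OF \<tau>[OF k]]) auto
    qed
    finally show ?thesis .
  qed
  \<comment> \<open>The integral is written as \<open>i\<close> equal terms, so that
    \<open>H_sum\<close> applies under the integral sign.\<close>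
  have "real i * (\<integral>\<omega>. G (\<lambda>r. Z r \<omega>) * H (\<lambda>r. Z r \<omega>) \<partial>M)
      = (\<Sum>k<i. \<integral>\<omega>. G (\<lambda>r. Z r \<omega>) * H (\<lambda>r. Z (\<tau> k r) \<omega>) \<partial>M)"
    using swap by simp
  also have "\<dots> = (\<integral>\<omega>. (\<Sum>k<i. G (\<lambda>r. Z r \<omega>) * H (\<lambda>r. Z (\<tau> k r) \<omega>)) \<partial>M)"
    using GH_int by (intro Bochner_Integration.integral_sum[symmetric]) auto
  also have "\<dots> \<le> (\<integral>\<omega>. real i * K * G (\<lambda>r. Z r \<omega>) \<partial>M)"
  proof (rule integral_mono)
    show "integrable M (\<lambda>\<omega>. \<Sum>k<i. G (\<lambda>r. Z r \<omega>) * H (\<lambda>r. Z (\<tau> k r) \<omega>))"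
      using GH_int by (intro Bochner_Integration.integrable_sum) auto
    show "integrable M (\<lambda>\<omega>. real i * K * G (\<lambda>r. Z r \<omega>))" using G_int by simp
    fix \<omega> assume "\<omega> \<in> space M"
    from mult_left_mono[OF H_sum[OF Zn[OF this]] G_pos[of "\<lambda>r. Z r \<omega>"]]
    show "(\<Sum>k<i. G (\<lambda>r. Z r \<omega>) * H (\<lambda>r. Z (\<tau> k r) \<omega>)) \<le> real i * K * G (\<lambda>r. Z r \<omega>)"
      by (simp add: mult.commute flip: sum_distrib_left)
  qed
  also have "\<dots> = real i * (K * (\<integral>\<omega>. G (\<lambda>r. Z r \<omega>) \<partial>M))" by simp
  finally have "(\<integral>\<omega>. G (\<lambda>r. Z r \<omega>) * H (\<lambda>r. Z r \<omega>) \<partial>M) \<le> K * (\<integral>\<omega>. G (\<lambda>r. Z r \<omega>) \<partial>M)"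
    using i by simp
  also have "\<dots> \<le> K * K ^ t"
    using Suc by (intro mult_left_mono) (auto simp: G_def E_def K_def conformal_e_value_def[abs_def])
  finally show ?case
    by (simp add: G_def H_def E_def K_def conformal_e_value_def[abs_def] algebra_simps exp_add)
qed

section \<open>From exponential moments to almost sure bounds\<close>

text \<open>Different \<open>n\<close> give different reverse procedures, so the sums do not form
  one martingale in \<open>n\<close>. Each \<open>n\<close> gets its own Chernoff bound, and the
  bounds are summable.\<close>

lemma AE_eventually_reverse_gain_less:
  assumes M: "prob_space M" and f: "conformal_e_predictor N f" and Z: "exchangeable M N Z"
    and c: "1 < c" and \<epsilon>: "0 < \<epsilon>" "\<epsilon> \<le> 1"
  shows "AE \<omega> in M. eventually (\<lambda>n.
    (\<Sum>s<n. reverse_gain c (conformal_e_value f Z \<omega>) n s) < \<epsilon> * real n) sequentially"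
proof -
  interpret prob_space M by (rule M)
  define S where "S n \<omega> = (\<Sum>s<n. reverse_gain c (conformal_e_value f Z \<omega>) n s)" for n \<omega>
  \<comment> \<open>This \<open>l\<close> minimises the exponent
    \<open>(l * c\<^sup>2)\<^sup>2 - l * \<epsilon>\<close>; the minimum is the exponent of
    \<open>q\<close>.\<close>
  define l where "l = \<epsilon> / (2 * c ^ 4)"
  define q where "q = exp (- (\<epsilon>\<^sup>2 / (4 * c ^ 4)))"
  have l: "0 < l" using \<epsilon> c by (simp add: l_def)
  have "1 \<le> c\<^sup>2" using c by simp
  \<comment> \<open>Here \<open>\<epsilon> \<le> 1\<close> makes \<open>l\<close> small enough for
    the quadratic bound.\<close>
  then have "\<epsilon> \<le> 2 * c\<^sup>2" using \<epsilon> by linarith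
  then have lc: "l * c\<^sup>2 \<le> 1" using c by (simp add: l_def field_simps power2_eq_square power4_eq_xxxx)
  have e_meas: "(\<lambda>\<omega>. conformal_e_value f Z \<omega> j) \<in> borel_measurable M" if "1 \<le> j" for j
    unfolding conformal_e_value_def
  proof (rule exchangeable_measurable[OF Z, where F = "\<lambda>x. f (map x [0..<j])" and n = j and \<pi> = "\<lambda>i. i"])
    show "(\<lambda>x. f (map x [0..<j])) \<in> borel_measurable (\<Pi>\<^sub>M i\<in>{..<j}. N)"
      using that by (intro conformal_e_predictor_measurable[OF f]) auto
    show "f (map x [0..<j]) = f (map y [0..<j])" if "\<And>i. i < j \<Longrightarrow> x i = y i" for x y
      using that by (intro arg_cong[where f = f]) auto
  qed
  have S_meas [measurable]: "S n \<in> borel_measurable M" for n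
    unfolding S_def by (intro borel_measurable_sum reverse_gain_measurable e_meas) auto
  have e_nonneg: "0 \<le> conformal_e_value f Z \<omega> j" if "\<omega> \<in> space M" "1 \<le> j" for \<omega> j
  proof -
    have "Z r \<omega> \<in> space N" for r
      using Z that unfolding exchangeable_def by (meson measurable_space)
    then show ?thesis
      unfolding conformal_e_value_def using that by (intro conformal_e_predictor_nonneg[OF f]) auto
  qed
  have S_le: "S n \<omega> \<le> (\<Sum>s<n. c\<^sup>2)" if "\<omega> \<in> space M" for n \<omega>
    unfolding S_def
  proof (rule sum_mono)
    fix s assume "s \<in> {..<n}"
    then show "reverse_gain c (conformal_e_value f Z \<omega>) n s \<le> c\<^sup>2"
      using abs_reverse_gain_le[OF c, of "conformal_e_value f Z \<omega>" n s] e_nonneg[OF that] by simp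
  qed
  have exp_int: "integrable M (\<lambda>\<omega>. exp (l * S n \<omega>))" for n
    using S_le l by (intro integrable_const_bound[where B = "exp (l * (\<Sum>s<n. c\<^sup>2))"])
      (auto intro!: mult_left_mono)
  have tail: "prob {\<omega> \<in> space M. \<epsilon> * real n \<le> S n \<omega>} \<le> q ^ n" for n
  proof -
    have "{\<omega> \<in> space M. \<epsilon> * real n \<le> S n \<omega>} = {\<omega> \<in> space M. exp (l * (\<epsilon> * real n)) \<le> exp (l * S n \<omega>)}"
      using l by simp
    also have "prob \<dots> \<le> (\<integral>\<omega>. exp (l * S n \<omega>) \<partial>M) / exp (l * (\<epsilon> * real n))"
      by (rule integral_Markov_inequality_measure[OF exp_int sets.empty_sets]) auto
    also have "\<dots> \<le> (1 + (l * c\<^sup>2)\<^sup>2) ^ n / exp (l * (\<epsilon> * real n))"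
      unfolding S_def using l lc
      by (intro divide_right_mono expectation_exp_reverse_gain_le[OF M f Z c]) auto
    also have "\<dots> \<le> exp ((l * c\<^sup>2)\<^sup>2) ^ n / exp (l * (\<epsilon> * real n))"
      by (intro divide_right_mono power_mono exp_ge_add_one_self) auto
    also have "\<dots> = exp ((l * c\<^sup>2)\<^sup>2 - l * \<epsilon>) ^ n"
      by (simp add: exp_diff power_divide mult.assoc flip: exp_of_nat_mult)
    also have "(l * c\<^sup>2)\<^sup>2 - l * \<epsilon> = - (\<epsilon>\<^sup>2 / (4 * c ^ 4))"
      using c by (simp add: l_def field_simps power2_eq_square power4_eq_xxxx)
    finally show ?thesis by (simp add: q_def)
  qed
  have "norm q < 1" using \<epsilon> c by (simp add: q_def)
  then have "summable (\<lambda>n. prob {\<omega> \<in> space M. \<epsilon> * real n \<le> S n \<omega>})"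
    using tail by (intro summable_comparison_test'[OF summable_geometric]) auto
  then have "AE \<omega> in M. eventually (\<lambda>n. \<omega> \<in> space M - {\<omega> \<in> space M. \<epsilon> * real n \<le> S n \<omega>}) sequentially"
    by (intro borel_cantelli_AE1) (auto simp: emeasure_eq_measure)
  then show ?thesis
    by eventually_elim (auto simp: S_def elim!: eventually_mono)
qed

theorem proposition5:
  fixes M :: "'w measure" and N :: "'a measure"
    and f :: "'a list \<Rightarrow> real" and Z :: "nat \<Rightarrow> 'w \<Rightarrow> 'a" and c :: real
  assumes "prob_space M"
    and "space N \<noteq> {}"
    and "conformal_e_predictor N f"
    and "exchangeable M N Z"
    and "c > 1"
  shows "AE \<omega> in M.
    limsup (\<lambda>n. ereal (real (cusum_alarm_count c (conformal_e_value f Z \<omega>) n) / real n))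
      \<le> ereal (1 / c)"
proof -
  interpret prob_space M by (rule assms(1))
  note c = assms(5)
  let ?A = "\<lambda>\<omega> n. real (cusum_alarm_count c (conformal_e_value f Z \<omega>) n)"
  \<comment> \<open>Countably many values of \<open>\<epsilon>\<close> suffice, so one null set
    serves them all.\<close>
  have "AE \<omega> in M. \<forall>k. eventually (\<lambda>n. (\<Sum>s<n. reverse_gain c (conformal_e_value f Z \<omega>) n s)
      < inverse (real (Suc k)) * real n) sequentially"
    unfolding AE_all_countable
    using assms by (intro allI AE_eventually_reverse_gain_less) (auto simp: field_simps)
  with AE_space show ?thesis
  proof eventually_elim
    fix \<omega>
    assume \<omega>: "\<omega> \<in> space M"
      and ev: "\<forall>k. eventually (\<lambda>n. (\<Sum>s<n. reverse_gain c (conformal_e_value f Z \<omega>) n s)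
        < inverse (real (Suc k)) * real n) sequentially"
    have "Z r \<omega> \<in> space N" for r
      using assms(4) \<omega> unfolding exchangeable_def by (meson measurable_space)
    then have e: "0 \<le> conformal_e_value f Z \<omega> j" if "1 \<le> j" for j
      unfolding conformal_e_value_def using that
      by (intro conformal_e_predictor_nonneg[OF assms(3)]) auto
    have bound: "limsup (\<lambda>n. ereal (?A \<omega> n / real n)) \<le> ereal ((1 + inverse (real (Suc k))) / c)" for k
    proof (rule Limsup_bounded)
      show "eventually (\<lambda>n. ereal (?A \<omega> n / real n) \<le> ereal ((1 + inverse (real (Suc k))) / c)) sequentially"
        using ev[rule_format, of k] eventually_gt_at_top[of 0]
      proof eventually_elim
        case (elim n)
        have "c * ?A \<omega> n \<le> real n + (\<Sum>s<n. reverse_gain c (conformal_e_value f Z \<omega>) n s)"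
          using cusum_alarm_count_le[OF c e] by simp
        also have "\<dots> \<le> (1 + inverse (real (Suc k))) * real n"
          using elim by (simp only: distrib_right)
        finally show ?case using c elim by (simp add: pos_divide_le_eq pos_le_divide_eq mult.commute)
      qed
    qed
    \<comment> \<open>On the fixed path, \<open>\<epsilon> = 1 / (k + 1)\<close> now tends to
      zero.\<close>
    have "(\<lambda>k. (1 + inverse (real (Suc k))) / c) \<longlonglongrightarrow> (1 + 0) / c"
      using c by (intro tendsto_intros LIMSEQ_inverse_real_of_nat) auto
    then have "(\<lambda>k. ereal ((1 + inverse (real (Suc k))) / c)) \<longlonglongrightarrow> ereal (1 / c)"
      by simp
    then show "limsup (\<lambda>n. ereal (?A \<omega> n / real n)) \<le> ereal (1 / c)"
      by (rule LIMSEQ_le_const) (use bound in blast)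
  qed
qed

end
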